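(* Let $G$ be a finite nonempty simple graph, let $\delta(G)$ be the minimum degree of $G$, and let $\chi'(G)$ be the chromatic index of $G$. Then $$d(G)\geq\max\left\{\left\lceil\frac{\chi'(G)}{2}\right\rceil,\delta(G)\right\}.$$
   Context: Nonempty means having at least one edge. A vertex labeling of a graph $G$ is an injective map $f:V(G)\to\mathbb{Z}$. It induces the edge labeling $f^-:E(G)\to\mathbb{Z}$, $f^-(uv)=|f(u)-f(v)|$, and $|f^-|$ denotes the number of distinct values $f^-$ takes on $E(G)$. The difference index $d(G)$ is the minimum positive integer $k$ such that there exists a vertex labeling $f$ of $G$ with $|f^-|=k$. The chromatic index is the minimum number of colors in a proper edge coloring. *)

theory Defs
  imports Complex_Main "Graph_Theory.Graph_Theory"
begin

text \<open>A finite simple graph is a \<^locale>\<open>pair_graph\<close>, that is, a finite loop-free symmetric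
  digraph: the undirected edge \<open>uv\<close> is the pair of arcs \<open>(u, v)\<close>, \<open>(v, u)\<close>.\<close>

definition uedges :: "'a pair_pre_digraph \<Rightarrow> 'a set set" where
  "uedges G = {{u, v} | u v. (u, v) \<in> parcs G}"

text \<open>The out-degree in the symmetric digraph counts each incident undirected edge once.\<close>

definition min_degree :: "'a pair_pre_digraph \<Rightarrow> nat" where
  "min_degree G = Min ((\<lambda>v. out_degree (with_proj G) v) ` pverts G)"

definition vertex_labeling :: "'a pair_pre_digraph \<Rightarrow> ('a \<Rightarrow> int) \<Rightarrow> bool" where
  "vertex_labeling G f \<longleftrightarrow> inj_on f (pverts G)"

text \<open>The induced edge labeling does not depend on the orientation of an edge, so taking it on
  arcs yields the same set of values as taking it on undirected edges.\<close>

definition edge_label :: "('a \<Rightarrow> int) \<Rightarrow> 'a \<times> 'a \<Rightarrow> int" where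
  "edge_label f = (\<lambda>(u, v). \<bar>f u - f v\<bar>)"

definition num_edge_labels :: "'a pair_pre_digraph \<Rightarrow> ('a \<Rightarrow> int) \<Rightarrow> nat" where
  "num_edge_labels G f = card (edge_label f ` parcs G)"

definition difference_index :: "'a pair_pre_digraph \<Rightarrow> nat" where
  "difference_index G =
     (LEAST k. k > 0 \<and> (\<exists>f. vertex_labeling G f \<and> num_edge_labels G f = k))"

definition proper_edge_coloring ::
  "'a pair_pre_digraph \<Rightarrow> nat \<Rightarrow> ('a set \<Rightarrow> nat) \<Rightarrow> bool" where
  "proper_edge_coloring G k c \<longleftrightarrow>
     c ` uedges G \<subseteq> {..<k} \<and>
     (\<forall>e \<in> uedges G. \<forall>e' \<in> uedges G. e \<noteq> e' \<and> e \<inter> e' \<noteq> {} \<longrightarrow> c e \<noteq> c e')"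

definition chromatic_index :: "'a pair_pre_digraph \<Rightarrow> nat" where
  "chromatic_index G = (LEAST k. \<exists>c. proper_edge_coloring G k c)"

end

theory Submission
  imports Defs
begin

text \<open>Let \<open>f\<close> be a labeling that uses exactly \<open>k = difference_index G\<close> edge labels.

  At the vertex with the largest label every difference to a neighbour has the same sign, so the
  incident edges carry distinct labels. Hence that vertex, and so the vertex of minimum degree,
  has at most \<open>k\<close> neighbours (\<open>min_degree_le_num_edge_labels\<close>).

  The edges of a fixed label \<open>d\<close> join values \<open>x\<close> and \<open>x + d\<close>. They therefore form disjoint paths
  inside the arithmetic progressions of difference \<open>d\<close> and can be coloured alternately with two
  colours. With a separate pair of colours for each label this is a proper edge colouring with
  \<open>2 * k\<close> colours (\<open>chromatic_index_le_twice_num_edge_labels\<close>).\<close>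

lemma uedges_nonempty_iff: "uedges G \<noteq> {} \<longleftrightarrow> parcs G \<noteq> {}"
  unfolding uedges_def by auto

text \<open>The least \<open>k\<close> in \<open>difference_index\<close> is a genuine minimum: finitely many vertices can be
  numbered injectively, and an edge makes the number of labels positive.\<close>

lemma difference_index_attained:
  assumes "pair_fin_digraph G" and "parcs G \<noteq> {}"
  obtains f where "vertex_labeling G f" "num_edge_labels G f = difference_index G"
proof -
  interpret pair_fin_digraph G by fact
  from finite_imp_inj_to_nat_seg[OF finite_verts]
  obtain g :: "'a \<Rightarrow> nat" where "inj_on g (pverts G)" by auto
  then have "vertex_labeling G (int \<circ> g)"
    unfolding vertex_labeling_def by (auto simp: inj_on_def)
  moreover have "num_edge_labels G (int \<circ> g) > 0"
    using assms(2) finite_arcs unfolding num_edge_labels_def by (simp add: card_gt_0_iff)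
  ultimately have "\<exists>k. k > 0 \<and> (\<exists>f. vertex_labeling G f \<and> num_edge_labels G f = k)"
    by blast
  from LeastI_ex[OF this] show thesis
    unfolding difference_index_def[symmetric] using that by blast
qed

text \<open>The vertex of largest label is the witness: there the label of an edge determines its
  other end.\<close>

lemma min_degree_le_num_edge_labels:
  assumes "pair_fin_digraph G" and "pverts G \<noteq> {}" and f: "vertex_labeling G f"
  shows "min_degree G \<le> num_edge_labels G f"
proof -
  interpret pair_fin_digraph G by fact
  have inj: "inj_on f (pverts G)" using f unfolding vertex_labeling_def .
  have "Max (f ` pverts G) \<in> f ` pverts G" using finite_verts assms(2) by (intro Max_in) auto
  then obtain v where v: "v \<in> pverts G" and fv: "f v = Max (f ` pverts G)" by auto
  have max: "f w \<le> f v" if "w \<in> pverts G" for w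
    using that finite_verts by (simp add: fv)
  have "inj_on (edge_label f) (out_arcs (with_proj G) v)"
  proof (rule inj_onI)
    fix a b
    assume a: "a \<in> out_arcs (with_proj G) v" and b: "b \<in> out_arcs (with_proj G) v"
      and eq: "edge_label f a = edge_label f b"
    obtain x where x: "a = (v, x)" "(v, x) \<in> parcs G" using a by (cases a) auto
    obtain y where y: "b = (v, y)" "(v, y) \<in> parcs G" using b by (cases b) auto
    have verts: "x \<in> pverts G" "y \<in> pverts G" using x y by (auto dest: in_arcsD2)
    have "f x = f y" using eq max[OF verts(1)] max[OF verts(2)] x y by (simp add: edge_label_def)
    with inj verts have "x = y" by (auto dest: inj_onD)
    then show "a = b" using x y by simp
  qed
  then have "out_degree (with_proj G) v \<le> num_edge_labels G f"
    unfolding out_degree_def num_edge_labels_def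
    using finite_arcs by (intro card_inj_on_le) auto
  moreover have "min_degree G \<le> out_degree (with_proj G) v"
    unfolding min_degree_def using finite_verts v by simp
  ultimately show ?thesis by simp
qed

text \<open>Each edge is a step in the positive direction, of length equal to its label; its lower end
  can then serve as the starting point of the step.\<close>

lemma uedge_ascending:
  assumes "pair_loopfree_digraph G" and f: "vertex_labeling G f" and "e \<in> uedges G"
  obtains u v where "e = {u, v}" "u \<in> pverts G" "v \<in> pverts G" "f u < f v"
    "f v - f u \<in> edge_label f ` parcs G"
proof -
  interpret pair_loopfree_digraph G by fact
  obtain u v where uv: "e = {u, v}" "(u, v) \<in> parcs G"
    using assms(3) unfolding uedges_def by auto
  have verts: "u \<in> pverts G" "v \<in> pverts G" "u \<noteq> v"
    using uv in_arcsD1 in_arcsD2 no_loops' by auto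
  then have "f u \<noteq> f v" using f unfolding vertex_labeling_def by (auto dest: inj_onD)
  moreover have "\<bar>f u - f v\<bar> \<in> edge_label f ` parcs G"
    using uv(2) by (force simp: edge_label_def)
  ultimately show thesis
    using that[of u v] that[of v u] uv(1) verts by (cases "f u < f v") (auto simp: insert_commute)
qed

text \<open>Consecutive terms of an arithmetic progression of difference \<open>d\<close> have quotients by \<open>d\<close> of
  opposite parity; this is what makes the two colours alternate along each path.\<close>

lemma div_parity_add_self:
  fixes x d :: int
  assumes "d > 0"
  shows "((x + d) div d) mod 2 \<noteq> (x div d) mod 2"
proof -
  have "(q + 1) mod 2 \<noteq> q mod 2" for q :: int by presburger
  moreover have "(x + d) div d = x div d + 1" using assms by simp
  ultimately show ?thesis by metis
qed

lemma chromatic_index_le: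
  assumes "proper_edge_coloring G k c"
  shows "chromatic_index G \<le> k"
  unfolding chromatic_index_def using assms by (blast intro: Least_le)

text \<open>Adjacent edges with different labels get different colours because their labels own disjoint
  pairs of colours. Distinct adjacent edges with the same label \<open>d\<close> are consecutive steps
  \<open>x, x + d, x + 2 * d\<close>, and the parity of the quotient of the lower value by \<open>d\<close> separates them.\<close>

lemma chromatic_index_le_twice_num_edge_labels:
  assumes "pair_loopfree_digraph G" and "finite (parcs G)" and f: "vertex_labeling G f"
  shows "chromatic_index G \<le> 2 * num_edge_labels G f"
proof -
  define L where "L = edge_label f ` parcs G"
  have inj: "inj_on f (pverts G)" using f unfolding vertex_labeling_def .
  have "finite L" using assms(2) unfolding L_def by simp
  then obtain idx :: "int \<Rightarrow> nat" where idx: "bij_betw idx L {0..<card L}"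
    using ex_bij_betw_finite_nat by blast
  \<comment> \<open>Label \<open>d\<close> owns the colours \<open>2 * idx d\<close> and \<open>2 * idx d + 1\<close>; the lower value \<open>x\<close> of an edge
    decides between them.\<close>
  define col where "col x d = 2 * idx d + nat ((x div d) mod 2)" for x d :: int
  \<comment> \<open>Taking the two values from the image keeps the colour independent of how the edge is
    written as a pair.\<close>
  define c where "c e = col (Min (f ` e)) (Max (f ` e) - Min (f ` e))" for e
  have c: "c {u, v} = col (f u) (f v - f u)" if "f u < f v" for u v
    using that by (simp add: c_def min_def max_def)
  have col_less: "col x d < 2 * card L" if "d \<in> L" for x d
  proof -
    have "idx d < card L" using bij_betwE[OF idx] that by auto
    moreover have "nat ((x div d) mod 2) < 2" by (simp add: nat_less_iff)
    ultimately show ?thesis unfolding col_def by linarith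
  qed
  have col_eqD: "d = d' \<and> (x div d) mod 2 = (x' div d') mod 2"
    if "d \<in> L" "d' \<in> L" "col x d = col x' d'" for x d x' d'
  proof -
    have bits: "nat ((x div d) mod 2) < 2" "nat ((x' div d') mod 2) < 2"
      by (simp_all add: nat_less_iff)
    have "idx d = idx d'" using that(3) bits unfolding col_def by linarith
    then have b: "nat ((x div d) mod 2) = nat ((x' div d') mod 2)"
      using that(3) unfolding col_def by simp
    have "d = d'" using \<open>idx d = idx d'\<close> idx that(1,2)
      unfolding bij_betw_def by (auto dest: inj_onD)
    moreover have "(x div d) mod 2 = (x' div d') mod 2" using b by (subst (asm) eq_nat_nat_iff) auto
    ultimately show ?thesis by blast
  qed
  have "proper_edge_coloring G (2 * card L) c"
    unfolding proper_edge_coloring_def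
  proof (intro conjI ballI impI subsetI)
    fix n assume "n \<in> c ` uedges G"
    then obtain e where e: "e \<in> uedges G" and n: "n = c e" by blast
    from uedge_ascending[OF assms(1) f e] obtain u v
      where "e = {u, v}" "f u < f v" "f v - f u \<in> L" unfolding L_def by metis
    then show "n \<in> {..<2 * card L}" using n c col_less by simp
  next
    fix e e' assume e: "e \<in> uedges G" and e': "e' \<in> uedges G" and adj: "e \<noteq> e' \<and> e \<inter> e' \<noteq> {}"
    from uedge_ascending[OF assms(1) f e] obtain u v
      where uv: "e = {u, v}" "u \<in> pverts G" "v \<in> pverts G" "f u < f v" "f v - f u \<in> L"
      unfolding L_def by metis
    from uedge_ascending[OF assms(1) f e'] obtain w z
      where wz: "e' = {w, z}" "w \<in> pverts G" "z \<in> pverts G" "f w < f z" "f z - f w \<in> L"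
      unfolding L_def by metis
    show "c e \<noteq> c e'"
    proof
      assume "c e = c e'"
      then have "col (f u) (f v - f u) = col (f w) (f z - f w)" using uv wz c by simp
      from col_eqD[OF uv(5) wz(5) this]
      have d: "f v - f u = f z - f w"
        and par: "(f u div (f v - f u)) mod 2 = (f w div (f v - f u)) mod 2" by auto
      \<comment> \<open>Two edges of equal label that start, or end, at a common vertex coincide, so the common
        vertex ends one edge and starts the other.\<close>
      have "f u \<noteq> f w"
      proof
        assume "f u = f w"
        with d have "f v = f z" by simp
        with \<open>f u = f w\<close> inj uv wz have "u = w" "v = z" by (auto dest: inj_onD)
        with adj uv(1) wz(1) show False by simp
      qed
      then have "f v = f w \<or> f z = f u"
        using adj uv(1) wz(1) d by auto
      then have "f w = f u + (f v - f u) \<or> f u = f w + (f v - f u)" using d by auto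
      then show False
        using par div_parity_add_self[of "f v - f u"] uv(4) by (metis diff_gt_0_iff_gt)
    qed
  qed
  from chromatic_index_le[OF this] show ?thesis
    unfolding num_edge_labels_def L_def .
qed

theorem theorem3p1:
  fixes G :: "'a pair_pre_digraph"
  assumes "pair_graph G"
    and "uedges G \<noteq> {}"
  shows "int (difference_index G) \<ge> max \<lceil>real (chromatic_index G) / 2\<rceil> (int (min_degree G))"
proof -
  interpret pair_graph G by fact
  have arcs: "parcs G \<noteq> {}" using assms(2) by (simp add: uedges_nonempty_iff)
  then have verts: "pverts G \<noteq> {}" using in_arcsD1 by fast
  from difference_index_attained[OF pair_fin_digraph_axioms arcs]
  obtain f where f: "vertex_labeling G f" and k: "num_edge_labels G f = difference_index G" .
  have "min_degree G \<le> difference_index G"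
    using min_degree_le_num_edge_labels[OF pair_fin_digraph_axioms verts f] k by simp
  moreover have "chromatic_index G \<le> 2 * difference_index G"
    using chromatic_index_le_twice_num_edge_labels[OF pair_loopfree_digraph_axioms finite_arcs f] k
    by simp
  then have "\<lceil>real (chromatic_index G) / 2\<rceil> \<le> int (difference_index G)"
    by (simp add: ceiling_le_iff)
  ultimately show ?thesis by simp
qed

end
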